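(* (1) For every $a\in\mathbb{C}$ with $3a\notin\{0,-1,-2,\dots\}$, $$F\!\left(a,\tfrac12-a;3a;\tfrac12\right)=\frac{2^{3/4-5a}\sqrt{\pi}\;\Gamma(\tfrac34)\,\Gamma(a+\tfrac13)\,\Gamma(a+\tfrac23)}{3^{3/8-3a}\,\Gamma(\tfrac{11}{24})\,\Gamma(\tfrac{19}{24})\,\Gamma(a+\tfrac38)\,\Gamma(a+\tfrac58)}.$$ (2) If $a=-1-n$ with $n\in\mathbb{Z}_{\ge0}$, then $$F\!\left(a,\tfrac12-a;3a;\tfrac12\right)=\frac{5\cdot 2^{5n-2}\,(\tfrac{13}{8},n)(\tfrac{11}{8},n)}{3^{3n}\,(\tfrac53,n)(\tfrac43,n)}.$$
   Context: $F(a,b;c;x)=\sum_{n\ge0}\frac{(a,n)(b,n)}{(c,n)(1,n)}x^n$ with $(\alpha,n)=\Gamma(\alpha+n)/\Gamma(\alpha)$ (so $(\alpha,n)=\alpha(\alpha+1)\cdots(\alpha+n-1)$ for $n\ge0$) is the Gauss hypergeometric series. When $a$ and $c$ are non-positive integers with $c<a$, it is defined as the finite sum $F(a,b;c;x):=\sum_{n=0}^{|a|}\frac{(a,n)(b,n)}{(c,n)(1,n)}x^n$. $1/\Gamma$ is interpreted as $0$ at the poles of $\Gamma$. *)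

theory Defs
  imports "HOL-Analysis.Analysis"
begin

definition hypergeo_term :: "complex \<Rightarrow> complex \<Rightarrow> complex \<Rightarrow> complex \<Rightarrow> nat \<Rightarrow> complex" where
  "hypergeo_term a b c x n =
     (pochhammer a n * pochhammer b n) / (pochhammer c n * pochhammer 1 n) * x ^ n"

text \<open>
  The first branch is the convention for non-positive integers \<open>a\<close>, \<open>c\<close> with \<open>c < a\<close>: the sum
  stops at \<open>n = \<bar>a\<bar>\<close>, before \<open>pochhammer c n\<close> vanishes. The second branch is meaningful when \<open>c\<close>
  is not a non-positive integer and the series converges, in particular for \<open>norm x < 1\<close>.
\<close>

definition hypergeo_F :: "complex \<Rightarrow> complex \<Rightarrow> complex \<Rightarrow> complex \<Rightarrow> complex" where
  "hypergeo_F a b c x =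
     (if a \<in> \<int>\<^sub>\<le>\<^sub>0 \<and> c \<in> \<int>\<^sub>\<le>\<^sub>0 \<and> Re c < Re a
      then (\<Sum>n = 0..nat \<lfloor>norm a\<rfloor>. hypergeo_term a b c x n)
      else (\<Sum>n. hypergeo_term a b c x n))"

end

theory Submission
  imports Defs "HOL-Complex_Analysis.Complex_Analysis" "HOL-Real_Asymp.Real_Asymp"
begin

text \<open>
  Let \<open>t a k\<close> be the summand of \<open>F(a, 1/2 - a; 3a; 1/2)\<close>. There is an explicit \<open>G a k\<close>, a rational
  function times \<open>t a k\<close>, such that
  \<open>(8a + 3) (8a + 5) t (a + 1) k - 6 (3a + 1) (3a + 2) t a k = G a (k + 1) - G a k\<close>
  (lemma \<open>wz_identity\<close>). Summed over \<open>k\<close>, this is a recurrence of first order in \<open>a\<close>. For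
  \<open>a = -1 - n\<close> all sums are finite and the recurrence gives the second formula by induction on \<open>n\<close>
  (\<open>hg_finite_sum\<close>).

  In the first formula the recurrence shows that the quotient of the two sides is periodic in \<open>a\<close> with
  period \<open>1\<close>, so for real \<open>a\<close> it remains to find its limit as \<open>a\<close> tends to infinity through
  \<open>a + n\<close>. Euler's integral (\<open>hg_series_Euler_integral\<close>) becomes, with \<open>s = 1 - t\<close>,
  \<open>\<integral> s\<^bsup>2a-1\<^esup> (1 - s\<^sup>2)\<^bsup>a-1\<^esup> sqrt (1 + s) ds\<close> over the unit interval, up to a power of \<open>2\<close>. Apart from
  the square root this is a Beta integral in \<open>s\<^sup>2\<close>, and its mass concentrates at \<open>s\<^sup>2 = 1/2\<close>. The limit
  is thus known up to Beta values (\<open>hg_series_concentration\<close>), and the duplication and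
  triplication formulas for \<open>\<Gamma>\<close> identify it with the constant in the theorem, which equals
  \<open>2 * cos (pi / 8) / sqrt 3\<close> (\<open>Gamma_constant_eq_cos\<close>).

  The series converges locally uniformly in \<open>a\<close>, so the identity theorem extends the first formula from
  the real numbers \<open>a > 1\<close> to all complex \<open>a\<close> for which \<open>3a\<close> is not a non-positive integer.
\<close>

section \<open>The telescoping contiguity relation\<close>

definition hg_term :: "'a::field_char_0 \<Rightarrow> nat \<Rightarrow> 'a" where
  "hg_term a k =
     pochhammer a k * pochhammer (1/2 - a) k / (pochhammer (3 * a) k * fact k * 2 ^ k)"

text \<open>
  The companion of the summand in the sense of Wilf and Zeilberger. Dividing the identity below by
  \<open>hg_term a k\<close> turns it into a linear system for the polynomial factor in \<open>k\<close>, whose solution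
  is the quadratic written here. The index \<open>k - 1\<close> at \<open>k = 0\<close> is harmless because of the factor
  \<open>of_nat k\<close>; writing \<open>pochhammer (1/2 - a) (k - 1)\<close> instead of dividing \<open>pochhammer (1/2 - a) k\<close> by
  its last factor keeps the certificate meaningful when \<open>a + 1/2\<close> is a natural number.
\<close>

definition wz_cert :: "'a::field_char_0 \<Rightarrow> nat \<Rightarrow> 'a" where
  "wz_cert a k =
     6 * (3 * a + 1) * (3 * a + 2) * of_nat k
       * (2 * of_nat k ^ 2 + 4 * a * of_nat k + 10 * a ^ 2 + 6 * a + 1)
       * pochhammer a k * pochhammer (1/2 - a) (k - 1)
     / (pochhammer (3 * a) (k + 2) * fact k * 2 ^ k)"

text \<open>
  The contiguity relation between the parameters \<open>(a, 1/2 - a, 3a)\<close> and \<open>(a + 1, -1/2 - a, 3a + 3)\<close>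
  at \<open>x = 1/2\<close>, in telescoping form. Contiguous functions usually satisfy relations with three terms;
  at this argument the third coefficient vanishes. Both the infinite and the terminating series are
  summed with it. The proof extracts the common factor of the four expressions, after which a
  polynomial identity in \<open>a\<close> and \<open>k\<close> remains.
\<close>

lemma wz_identity:
  fixes a :: "'a::field_char_0"
  assumes "pochhammer (3 * a) (k + 3) \<noteq> 0"
  shows "(8 * a + 3) * (8 * a + 5) * hg_term (a + 1) k
         - 6 * (3 * a + 1) * (3 * a + 2) * hg_term a k
         = wz_cert a (Suc k) - wz_cert a k"
proof (cases k)
  case 0
  have "3 * a * (3 * a + 1) * (3 * a + 2) \<noteq> 0"
    using assms 0 by (simp add: pochhammer_Suc numeral_3_eq_3 numeral_2_eq_2)
  then have nz: "a \<noteq> 0" "3 * a + 1 \<noteq> 0" "3 * a + 2 \<noteq> 0" by auto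
  have p3: "pochhammer (3 * a) (Suc (Suc (Suc 0))) = 3 * a * (3 * a + 1) * (3 * a + 2)"
    by (simp add: pochhammer_Suc)
  show ?thesis
    using nz unfolding hg_term_def wz_cert_def 0
    by (simp add: p3 numeral_2_eq_2 del: pochhammer_Suc0) (simp add: divide_simps, algebra)
next
  case (Suc j)
  define x :: 'a where "x = of_nat j"
  define A where "A = pochhammer (a + 1) j"
  define B where "B = pochhammer (1/2 - a) j"
  define C where "C = pochhammer (3 * a + 3) j"
  have c3: "pochhammer (3 * a) (j + 3) = 3 * a * (3 * a + 1) * (3 * a + 2) * C"
    using pochhammer_product'[of "3 * a" 3 j]
    by (simp add: C_def pochhammer_Suc numeral_3_eq_3 add.commute)
  have c4: "pochhammer (3 * a) (j + 4) = 3 * a * (3 * a + 1) * (3 * a + 2) * C * (3 * a + x + 3)"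
    using pochhammer_Suc[of "3 * a" "j + 3"] c3 by (simp add: x_def add_ac eval_nat_numeral)
  have nz0: "3 * a * (3 * a + 1) * (3 * a + 2) * C * (3 * a + x + 3) \<noteq> 0"
    using assms c4 Suc by (simp add: eval_nat_numeral)
  then have nz: "a \<noteq> 0" "3 * a + 1 \<noteq> 0" "3 * a + 2 \<noteq> 0" "C \<noteq> 0" "3 * a + x + 3 \<noteq> 0" by auto
  define c1 where "c1 = pochhammer (3 * a) (Suc j)"
  have c31: "3 * a * (3 * a + 1) * (3 * a + 2) * C = c1 * (3 * a + x + 1) * (3 * a + x + 2)"
    using c3 pochhammer_Suc[of "3 * a" "Suc (Suc j)"] pochhammer_Suc[of "3 * a" "Suc j"]
    by (simp add: c1_def x_def eval_nat_numeral algebra_simps)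
  with nz have nz2: "3 * a + x + 1 \<noteq> 0" "3 * a + x + 2 \<noteq> 0" "c1 \<noteq> 0" by auto
  have a1: "pochhammer a (Suc j) = a * A" by (simp add: A_def pochhammer_rec)
  have a2: "pochhammer a (Suc (Suc j)) = a * A * (a + 1 + x)"
    by (simp add: pochhammer_Suc[of a "Suc j"] a1 x_def)
  have a1': "pochhammer (a + 1) (Suc j) = A * (a + 1 + x)"
    by (simp add: A_def pochhammer_Suc x_def)
  have b1: "pochhammer (1/2 - a) (Suc j) = B * (1/2 - a + x)"
    by (simp add: B_def pochhammer_Suc x_def)
  have b0: "pochhammer (1/2 - (a + 1)) (Suc j) = (-1/2 - a) * B"
    by (simp add: B_def pochhammer_rec algebra_simps)
  have c': "pochhammer (3 * (a + 1)) (Suc j) = C * (3 * a + 3 + x)"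
    by (simp add: C_def pochhammer_Suc x_def algebra_simps)
  have x1: "1 + x \<noteq> 0" "2 + x \<noteq> 0" using of_nat_eq_0_iff[of "1 + j", where 'a = 'a] of_nat_eq_0_iff[of "2 + j", where 'a = 'a]
    by (simp_all add: x_def del: of_nat_eq_0_iff)
  define D where "D = A * B / (C * fact j * 2 ^ j)"
  have tl: "hg_term (a + 1) k = D * (a + 1 + x) * (-1/2 - a) / ((3 * a + 3 + x) * (1 + x) * 2)"
    unfolding hg_term_def Suc a1' b0 c' using nz x1
    by (simp add: D_def x_def[symmetric] mult_ac)
  have tr: "hg_term a k = D * (1/2 - a + x) * (3 * a + x + 1) * (3 * a + x + 2)
              / (3 * (3 * a + 1) * (3 * a + 2) * (1 + x) * 2)"
  proof -
    have c1: "c1 = 3 * a * (3 * a + 1) * (3 * a + 2) * C / ((3 * a + x + 1) * (3 * a + x + 2))"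
      unfolding c31 using nz2 by simp
    show ?thesis
      unfolding hg_term_def Suc a1 b1 c1_def[symmetric] c1 using nz nz2 x1
      by (simp add: D_def x_def[symmetric] mult_ac del: distrib_left_numeral)
  qed
  have gl: "wz_cert a k = 6 * (3 * a + 1) * (3 * a + 2) * D
       * (2 * (1 + x) ^ 2 + 4 * a * (1 + x) + 10 * a ^ 2 + 6 * a + 1)
       / (3 * (3 * a + 1) * (3 * a + 2) * 2)"
    unfolding wz_cert_def Suc using nz nz2 x1 a1 c3
    by (simp add: D_def x_def[symmetric] B_def[symmetric] eval_nat_numeral del: distrib_left_numeral)
  have gr: "wz_cert a (Suc k) = 6 * (3 * a + 1) * (3 * a + 2) * D
       * (2 * (2 + x) ^ 2 + 4 * a * (2 + x) + 10 * a ^ 2 + 6 * a + 1) * (a + 1 + x) * (1/2 - a + x)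
       / (3 * (3 * a + 1) * (3 * a + 2) * (3 * a + x + 3) * (1 + x) * 4)"
    unfolding wz_cert_def Suc using nz nz2 x1 a2 c4 b1
    by (simp add: D_def x_def[symmetric] eval_nat_numeral del: distrib_left_numeral)
  define p q where "p = 3 * a + 1" and "q = 3 * a + 2"
  define y where "y = 3 * a + x + 3"
  define z where "z = 1 + x"
  define q0 where "q0 = 2 * (1 + x) ^ 2 + 4 * a * (1 + x) + 10 * a ^ 2 + 6 * a + 1"
  define q1 where "q1 = 2 * (2 + x) ^ 2 + 4 * a * (2 + x) + 10 * a ^ 2 + 6 * a + 1"
  have nz': "p \<noteq> 0" "q \<noteq> 0" "y \<noteq> 0" "z \<noteq> 0"
    using nz x1 by (simp_all add: p_def q_def y_def z_def)
  have y: "3 * a + 3 + x = y" by (simp add: y_def)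
  define E where "E = D / (4 * y * z)"
  have D: "D = E * (4 * y * z)" using nz' by (simp add: E_def)
  have "hg_term (a + 1) k = - E * (1 + 2 * a) * (a + 1 + x)"
    unfolding tl y D z_def[symmetric] using nz' by (simp add: field_simps)
  moreover have "6 * p * q * hg_term a k
      = 2 * E * (1 - 2 * a + 2 * x) * (3 * a + x + 1) * (3 * a + x + 2) * y"
    unfolding tr D z_def[symmetric] p_def[symmetric] q_def[symmetric] using nz'
    by (simp add: divide_simps)
  moreover have "wz_cert a k = 4 * E * y * z * q0"
    unfolding gl D z_def[symmetric] p_def[symmetric] q_def[symmetric] using nz'
    by (simp add: q0_def z_def)
  moreover have "wz_cert a (Suc k) = E * q1 * (a + 1 + x) * (1 - 2 * a + 2 * x)"
    unfolding gr D z_def[symmetric] p_def[symmetric] q_def[symmetric] y_def[symmetric]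
      q1_def[symmetric] using nz'
    by (simp add: divide_simps)
  moreover have "(8 * a + 3) * (8 * a + 5) * (- (1 + 2 * a) * (a + 1 + x))
      - 2 * (1 - 2 * a + 2 * x) * (3 * a + x + 1) * (3 * a + x + 2) * y
      = q1 * (a + 1 + x) * (1 - 2 * a + 2 * x) - 4 * y * z * q0"
    unfolding q0_def q1_def y_def z_def by algebra
  ultimately show ?thesis unfolding p_def[symmetric] q_def[symmetric] by algebra
qed

text \<open>
  For a negative integer \<open>a\<close> the terminating sum is not the value of the analytic continuation of the
  infinite series: as \<open>a\<close> approaches the integer, the terms in which both \<open>pochhammer a k\<close> and
  \<open>pochhammer (3 * a) k\<close> tend to \<open>0\<close> keep a nonzero limit. The finite sums therefore need their own
  recurrence. It has no boundary terms, since \<open>pochhammer a k\<close> vanishes at the upper end.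
\<close>

lemma hg_finite_sum_step:
  fixes m :: nat
  assumes "m \<ge> 1"
  defines "a \<equiv> - of_nat (Suc m) :: 'a::field_char_0"
  shows "(8 * a + 3) * (8 * a + 5) * (\<Sum>k\<le>m. hg_term (a + 1) k)
         = 6 * (3 * a + 1) * (3 * a + 2) * (\<Sum>k\<le>Suc m. hg_term a k)"
proof -
  have nz: "pochhammer (3 * a) (k + 3) \<noteq> 0" if "k \<le> Suc m" for k
  proof
    assume "pochhammer (3 * a) (k + 3) = 0"
    then obtain i where i: "i < k + 3" "3 * a = - of_nat i"
      by (auto simp: pochhammer_eq_0_iff)
    have "of_nat (3 * Suc m) = (of_nat i :: 'a)" using arg_cong[OF i(2), of uminus] unfolding a_def by (simp add: add.commute)
    then have "3 * Suc m = i" using of_nat_eq_iff by blast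
    with i(1) that assms(1) show False by simp
  qed
  have top: "hg_term (a + 1) (Suc m) = 0"
  proof -
    have "pochhammer (a + 1) (Suc m) = 0" by (simp add: a_def pochhammer_eq_0_iff)
    then show ?thesis by (simp add: hg_term_def)
  qed
  have bdry: "wz_cert a (Suc (Suc m)) = 0" "wz_cert a 0 = 0"
  proof -
    have "pochhammer a (Suc (Suc m)) = 0" unfolding a_def pochhammer_eq_0_iff by blast
    then show "wz_cert a (Suc (Suc m)) = 0" by (simp add: wz_cert_def)
  qed (simp add: wz_cert_def)
  have "(8 * a + 3) * (8 * a + 5) * (\<Sum>k\<le>Suc m. hg_term (a + 1) k)
         - 6 * (3 * a + 1) * (3 * a + 2) * (\<Sum>k\<le>Suc m. hg_term a k)
        = (\<Sum>k\<le>Suc m. wz_cert a (Suc k) - wz_cert a k)"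
    unfolding sum_distrib_left sum_subtractf[symmetric]
    by (intro sum.cong refl wz_identity nz) simp
  also have "\<dots> = 0"
    using bdry by (simp only: lessThan_Suc_atMost[symmetric] sum_lessThan_telescope) simp
  finally show ?thesis using top by simp
qed

lemma hg_finite_sum:
  "(\<Sum>k\<le>Suc n. hg_term (- 1 - of_nat n :: 'a::field_char_0) k) =
     (5 * 2 powi (5 * int n - 2) * pochhammer (13/8) n * pochhammer (11/8) n)
       / (3 ^ (3 * n) * pochhammer (5/3) n * pochhammer (4/3) n)"
proof (induction n)
  case 0
  show ?case by (simp add: hg_term_def power_int_minus field_simps)
next
  case (Suc n)
  define x :: 'a where "x = of_nat n"
  have sh: "- 1 - of_nat (Suc n) = (- of_nat (Suc (Suc n)) :: 'a)"
    "- of_nat (Suc (Suc n)) + 1 = (- 1 - of_nat n :: 'a)" by simp_all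
  have nz: "3 * x + 4 \<noteq> 0" "3 * x + 5 \<noteq> 0"
    using of_nat_eq_0_iff[of "3 * n + 4", where 'a = 'a] of_nat_eq_0_iff[of "3 * n + 5", where 'a = 'a]
    by (simp_all add: x_def del: of_nat_eq_0_iff)
  have "18 * x + 30 = 6 * (3 * x + 5)" by simp
  with nz have nz': "18 * x + 30 \<noteq> 0" by (metis mult_eq_0_iff zero_neq_numeral)
  have p: "pochhammer (13/8) (Suc n) = pochhammer (13/8) n * (13/8 + x)"
    "pochhammer (11/8) (Suc n) = pochhammer (11/8) n * (11/8 + x)"
    "pochhammer (5/3) (Suc n) = pochhammer (5/3) n * (5/3 + x)"
    "pochhammer (4/3) (Suc n) = pochhammer (4/3) n * (4/3 + x)"
    by (simp_all add: pochhammer_Suc x_def)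
  have pw: "2 powi (5 * int (Suc n) - 2) = (32 * 2 powi (5 * int n - 2) :: 'a)"
    using power_int_add[of "2::'a" 5 "5 * int n - 2"] by (simp add: algebra_simps)
  have pw3: "3 ^ (3 * Suc n) = (27 * 3 ^ (3 * n) :: 'a)" by (simp add: power_add)
  have "(8 * x + 13) * (8 * x + 11) * (\<Sum>k\<le>Suc n. hg_term (- 1 - of_nat n :: 'a) k)
     = 6 * (3 * x + 5) * (3 * x + 4) * (\<Sum>k\<le>Suc (Suc n). hg_term (- 1 - of_nat (Suc n) :: 'a) k)"
    using hg_finite_sum_step[of "Suc n", where 'a = 'a] unfolding sh
    by (simp add: x_def algebra_simps del: sum.atMost_Suc)
  then have "(\<Sum>k\<le>Suc (Suc n). hg_term (- 1 - of_nat (Suc n) :: 'a) k)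
     = (8 * x + 13) * (8 * x + 11) / (6 * (3 * x + 5) * (3 * x + 4))
       * (\<Sum>k\<le>Suc n. hg_term (- 1 - of_nat n :: 'a) k)"
    using nz nz' by (simp only: times_divide_eq_left) (simp del: sum.atMost_Suc)
  also have "(8 * x + 13) * (8 * x + 11) / (6 * (3 * x + 5) * (3 * x + 4))
     = 32 * (13/8 + x) * (11/8 + x) / (27 * (5/3 + x) * (4/3 + x))"
  proof -
    have *: "5/3 + x = (3 * x + 5) / 3" "4/3 + x = (3 * x + 4) / 3"
      "13/8 + x = (8 * x + 13) / 8" "11/8 + x = (8 * x + 11) / 8" by (simp_all add: field_simps)
    show ?thesis by (simp only: *) (simp del: distrib_left_numeral distrib_right_numeral)
  qed
  finally show ?case
    unfolding Suc.IH p pw pw3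
    by (simp add: mult_ac del: sum.atMost_Suc distrib_left_numeral distrib_right_numeral)
qed

section \<open>Values of the Gamma function\<close>

lemma pos_notin_nonpos_Ints: "(x::real) > 0 \<Longrightarrow> x \<notin> \<int>\<^sub>\<le>\<^sub>0"
  by (auto elim!: nonpos_Ints_cases)

text \<open>
  This is Gauss's product for \<open>\<Gamma>\<close>, with the Pochhammer symbol expressed through \<open>\<Gamma>\<close>. It
  is the only form of Stirling's formula that is needed: in each application the factorials cancel or
  do not depend on \<open>x\<close>.
\<close>

lemma Gamma_shift_asymptotics:
  fixes x :: real
  assumes "x > 0"
  shows "(\<lambda>n. Gamma (x + of_nat n) / (fact (n - 1) * of_nat n powr x)) \<longlonglongrightarrow> 1"
proof -
  have nz: "Gamma x \<noteq> 0" using Gamma_real_pos[OF assms] by linarith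
  have "(\<lambda>n. inverse (Gamma_series' x n / Gamma x)) \<longlonglongrightarrow> inverse (Gamma x / Gamma x)"
    using nz by (intro tendsto_intros Gamma_series'_LIMSEQ) auto
  moreover have "eventually (\<lambda>n. inverse (Gamma_series' x n / Gamma x) =
      Gamma (x + of_nat n) / (fact (n - 1) * of_nat n powr x)) sequentially"
    using eventually_gt_at_top[of 0]
  proof eventually_elim
    case (elim n)
    then show ?case
      using nz assms
      by (simp add: Gamma_series'_def pochhammer_Gamma pos_notin_nonpos_Ints powr_def mult_ac)
  qed
  ultimately have "(\<lambda>n. Gamma (x + of_nat n) / (fact (n - 1) * of_nat n powr x))
      \<longlonglongrightarrow> inverse (Gamma x / Gamma x)"
    by (rule Lim_transform_eventually)
  then show ?thesis using nz by simp
qed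

lemma pochhammer_triple:
  fixes z :: "'a::field_char_0"
  shows "pochhammer (3 * z) (3 * n)
    = 27 ^ n * (pochhammer z n * pochhammer (z + 1/3) n * pochhammer (z + 2/3) n)"
proof (induction n)
  case (Suc n)
  have "pochhammer (3 * z) (3 * Suc n) = pochhammer (3 * z) (3 * n)
      * ((3 * z + 3 * of_nat n) * (3 * z + 3 * of_nat n + 1) * (3 * z + 3 * of_nat n + 2))"
    using pochhammer_product'[of "3 * z" "3 * n" 3]
    by (simp add: pochhammer_Suc numeral_3_eq_3 add_ac mult_ac)
  also have "\<dots> = 27 ^ Suc n *
      (pochhammer z n * (z + of_nat n) * (pochhammer (z + 1/3) n * (z + 1/3 + of_nat n))
        * (pochhammer (z + 2/3) n * (z + 2/3 + of_nat n)))"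
    unfolding Suc.IH by (simp add: field_simps)
  finally show ?case by (simp add: pochhammer_Suc)
qed simp

lemma Gamma_reflection_real':
  fixes x :: real
  shows "Gamma x * Gamma (1 - x) = pi / sin (pi * x)"
proof -
  have "complex_of_real (Gamma x * Gamma (1 - x)) = complex_of_real (pi / sin (pi * x))"
    using Gamma_reflection_complex[of "of_real x"]
    by (simp add: Gamma_complex_of_real[symmetric] sin_of_real[symmetric])
  then show ?thesis using of_real_eq_iff by blast
qed

lemma Gamma_duplication_real:
  fixes x :: real
  assumes "x > 0"
  shows "Gamma x * Gamma (x + 1/2) = 2 powr (1 - 2 * x) * sqrt pi * Gamma (2 * x)"
proof -
  have x: "complex_of_real x \<notin> \<int>\<^sub>\<le>\<^sub>0" "complex_of_real (x + 1/2) \<notin> \<int>\<^sub>\<le>\<^sub>0"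
    using assms pos_notin_nonpos_Ints[of x] pos_notin_nonpos_Ints[of "x + 1/2"]
    by (simp_all only: of_real_in_nonpos_Ints_iff) simp_all
  have "complex_of_real (Gamma x * Gamma (x + 1/2))
      = Gamma (complex_of_real x) * Gamma (complex_of_real x + 1/2)"
    using Gamma_complex_of_real[of "x + 1/2"] by (simp add: Gamma_complex_of_real)
  also have "\<dots> = exp (complex_of_real ((1 - 2 * x) * ln 2)) * complex_of_real (sqrt pi)
      * Gamma (complex_of_real (2 * x))"
    using Gamma_legendre_duplication[of "of_real x"] x by simp
  also have "\<dots> = complex_of_real (2 powr (1 - 2 * x) * sqrt pi * Gamma (2 * x))"
    by (simp only: Gamma_complex_of_real exp_of_real) (simp add: powr_def)
  finally show ?thesis using of_real_eq_iff by blast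
qed

text \<open>
  Gauss's multiplication formula for three factors. By the asymptotics above, the quotient
  \<open>\<Gamma> (3 z) / (3 powr (3 z) * \<Gamma> z * \<Gamma> (z + 1/3) * \<Gamma> (z + 2/3))\<close> is the limit of a sequence that does
  not depend on \<open>z\<close>; the reflection formula gives its value at \<open>z = 1/3\<close>.
\<close>

lemma Gamma_triplication_real:
  fixes z :: real
  assumes "z > 0"
  shows "Gamma z * Gamma (z + 1/3) * Gamma (z + 2/3) = 2 * pi * 3 powr (1/2 - 3 * z) * Gamma (3 * z)"
proof -
  define P where "P z = Gamma z * Gamma (z + 1/3) * Gamma (z + 2/3)" for z :: real
  define d :: "nat \<Rightarrow> real" where "d n = fact (3 * n - 1) / (27 ^ n * fact (n - 1) ^ 3 * of_nat n)" for n
  have lim: "d \<longlonglongrightarrow> Gamma (3 * z) / (P z * 3 powr (3 * z))" if z: "z > 0" for z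
  proof -
    define g where "g x n = Gamma (x + of_nat n) / (fact (n - 1) * of_nat n powr x)"
      for x :: real and n :: nat
    have g: "(\<lambda>n. g x n) \<longlonglongrightarrow> 1" if "x > 0" for x
      unfolding g_def by (rule Gamma_shift_asymptotics[OF that])
    have g3: "(\<lambda>n. g (3 * z) (3 * n)) \<longlonglongrightarrow> 1"
      by (rule filterlim_compose[OF g]) (use z in \<open>auto intro!: mult_nat_left_at_top\<close>)
    have nz: "P z > 0" "Gamma (3 * z) > 0" using z by (auto simp: P_def)
    have "(\<lambda>n. g z n * g (z + 1/3) n * g (z + 2/3) n / g (3 * z) (3 * n)
          * (Gamma (3 * z) / (P z * 3 powr (3 * z))))
        \<longlonglongrightarrow> 1 * 1 * 1 / 1 * (Gamma (3 * z) / (P z * 3 powr (3 * z)))"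
      using z by (intro tendsto_intros g g3) auto
    moreover have "eventually (\<lambda>n. g z n * g (z + 1/3) n * g (z + 2/3) n / g (3 * z) (3 * n)
          * (Gamma (3 * z) / (P z * 3 powr (3 * z))) = d n) sequentially"
      using eventually_gt_at_top[of 0]
    proof eventually_elim
      case (elim n)
      have G: "Gamma (x + of_nat n) = pochhammer x n * Gamma x" if "x > 0" for x :: real and n :: nat
        using that by (simp add: pochhammer_Gamma pos_notin_nonpos_Ints Gamma_eq_zero_iff)
      have G3: "Gamma (3 * z + of_nat (3 * n)) =
          27 ^ n * (pochhammer z n * pochhammer (z + 1/3) n * pochhammer (z + 2/3) n) * Gamma (3 * z)"
        using G[of "3 * z" "3 * n"] z by (simp only: pochhammer_triple)
      have pw: "(3 * real n) powr (3 * z) = 3 powr (3 * z) * (n powr z) ^ 3"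
        using elim by (simp add: powr_mult powr_power)
      have pw3: "n powr (z + 1/3) * n powr (z + 2/3) = (n powr z) ^ 2 * n"
        using elim by (simp add: powr_add[symmetric] powr_power) (simp add: powr_add)
      have pos: "pochhammer z n > 0" "pochhammer (z + 1/3) n > 0" "pochhammer (z + 2/3) n > 0"
        "Gamma z > 0" "Gamma (z + 1/3) > 0" "Gamma (z + 2/3) > 0" "Gamma (3 * z) > 0"
        "n powr z > 0" "3 powr (3 * z) > 0"
        using z elim by (auto intro!: pochhammer_pos)
      have "g z n * g (z + 1/3) n * g (z + 2/3) n =
          pochhammer z n * pochhammer (z + 1/3) n * pochhammer (z + 2/3) n * P z
            / (fact (n - 1) ^ 3 * ((n powr z) ^ 3 * n))"
      proof -
        have "g z n * g (z + 1/3) n * g (z + 2/3) n =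
          pochhammer z n * pochhammer (z + 1/3) n * pochhammer (z + 2/3) n * P z
            / (fact (n - 1) ^ 3 * (n powr z * (n powr (z + 1/3) * n powr (z + 2/3))))"
          unfolding g_def using z by (simp add: G P_def power3_eq_cube mult_ac)
        then show ?thesis unfolding pw3 by (simp add: power3_eq_cube power2_eq_square mult_ac)
      qed
      moreover have "g (3 * z) (3 * n) =
          27 ^ n * (pochhammer z n * pochhammer (z + 1/3) n * pochhammer (z + 2/3) n) * Gamma (3 * z)
           / (fact (3 * n - 1) * (3 powr (3 * z) * (n powr z) ^ 3))"
        unfolding g_def G3 using pw by simp
      ultimately show ?case using pos nz elim by (simp add: d_def)
    qed
    ultimately have "d \<longlonglongrightarrow> 1 * 1 * 1 / 1 * (Gamma (3 * z) / (P z * 3 powr (3 * z)))"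
      by (rule Lim_transform_eventually)
    then show ?thesis by simp
  qed
  have "P (1/3) = 2 * pi / sqrt 3"
    using Gamma_reflection_real'[of "1/3"] by (simp add: P_def sin_60)
  moreover have "Gamma (3 * z) / (P z * 3 powr (3 * z)) = Gamma (3 * (1/3)) / (P (1/3) * 3 powr (3 * (1/3)))"
    using LIMSEQ_unique[OF lim[OF assms] lim[of "1/3"]] by simp
  ultimately have "Gamma (3 * z) / (P z * 3 powr (3 * z)) = sqrt 3 / (2 * pi * 3)" by simp
  moreover have "P z > 0" using assms by (auto simp: P_def)
  ultimately have "P z = Gamma (3 * z) / 3 powr (3 * z) * (2 * pi * 3) / sqrt 3"
    by (simp add: field_simps)
  also have "\<dots> = 2 * pi * 3 powr (1/2 - 3 * z) * Gamma (3 * z)"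
  proof -
    have "3 / sqrt 3 = sqrt (3::real)" by (simp add: real_div_sqrt)
    moreover have "3 powr (1/2 - 3 * z) = sqrt 3 / 3 powr (3 * z)"
      by (simp add: powr_diff powr_half_sqrt)
    moreover have "Gamma (3 * z) / 3 powr (3 * z) * (2 * pi * 3) / sqrt 3
        = Gamma (3 * z) / 3 powr (3 * z) * (2 * pi) * (3 / sqrt 3)" by simp
    ultimately show ?thesis by simp
  qed
  finally show ?thesis by (simp add: P_def)
qed

text \<open>
  The constant of the closed form is algebraic: triplication at \<open>1/8\<close>, duplication at \<open>3/8\<close> and
  reflection at \<open>1/8\<close> eliminate every Gamma value. The saddle point estimate below yields it as
  \<open>sqrt 2 / sqrt 3\<close> times \<open>sqrt (1 + sqrt (1/2)) = sqrt 2 * cos (pi / 8)\<close>.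
\<close>

lemma Gamma_constant_eq_cos:
  "2 powr (3/4) * sqrt pi * Gamma (3/4) / (3 powr (3/8) * Gamma (11/24) * Gamma (19/24))
    = 2 * cos (pi / 8) / sqrt 3"
proof -
  have T: "Gamma (1/8) * Gamma (11/24) * Gamma (19/24) = 2 * pi * 3 powr (1/8) * Gamma (3/8 :: real)"
    using Gamma_triplication_real[of "1/8"] by simp
  have D: "Gamma (3/8) * Gamma (7/8) = 2 powr (1/4) * sqrt pi * Gamma (3/4 :: real)"
    using Gamma_duplication_real[of "3/8"] by simp
  have R: "Gamma (1/8) * Gamma (7/8) = pi / sin (pi / 8)"
    using Gamma_reflection_real'[of "1/8"] by simp
  have pos: "Gamma (1/8 :: real) > 0" "Gamma (11/24 :: real) > 0" "Gamma (19/24 :: real) > 0"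
    "Gamma (3/8 :: real) > 0" "Gamma (7/8 :: real) > 0" by auto
  have s: "sin (pi / 8) > 0" by (intro sin_gt_zero) auto
  have "2 * sin (pi / 8) * cos (pi / 8) = sqrt 2 / 2"
    using sin_double[of "pi / 8"] by (simp add: sin_45)
  then have c: "cos (pi / 8) = sqrt 2 / (4 * sin (pi / 8))" using s by (simp add: field_simps)
  have G: "Gamma (11/24) * Gamma (19/24) = 2 * pi * 3 powr (1/8) * Gamma (3/8 :: real) / Gamma (1/8)"
    unfolding T[symmetric] using pos(1) by (simp del: Gamma_real_pos)
  have G34: "sqrt pi * Gamma (3/4 :: real) = Gamma (3/8) * Gamma (7/8) / 2 powr (1/4)"
    using D by (simp add: field_simps)
  have "2 powr (3/4) * sqrt pi * Gamma (3/4) / (3 powr (3/8) * Gamma (11/24) * Gamma (19/24))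
     = 2 powr (3/4) * (sqrt pi * Gamma (3/4)) / (3 powr (3/8) * (Gamma (11/24) * Gamma (19/24 :: real)))"
    by (simp add: mult_ac)
  also have "\<dots> = 2 powr (3/4) / 2 powr (1/4) / (3 powr (3/8) * 3 powr (1/8)) * (Gamma (1/8) * Gamma (7/8)) / (2 * pi)"
    unfolding G G34 by (simp add: Gamma_eq_zero_iff pos_notin_nonpos_Ints mult_ac)
  also have "2 powr (3/4) / 2 powr (1/4) = sqrt (2::real)"
    by (simp add: powr_diff[symmetric] powr_half_sqrt)
  also have "3 powr (3/8) * 3 powr (1/8) = sqrt (3::real)"
    by (simp add: powr_add[symmetric] powr_half_sqrt)
  also have "sqrt 2 / sqrt 3 * (Gamma (1/8) * Gamma (7/8)) / (2 * pi) = 2 * cos (pi / 8) / sqrt 3"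
    unfolding R c using s by simp
  finally show ?thesis .
qed

section \<open>Convergence and analyticity in the parameter\<close>

lemma hg_term_of_real: "hg_term (complex_of_real a) k = complex_of_real (hg_term a k)"
proof -
  have "1/2 - complex_of_real a = of_real (1/2 - a)" "3 * complex_of_real a = of_real (3 * a)" by simp_all
  then show ?thesis unfolding hg_term_def by (simp only: pochhammer_of_real) simp
qed

lemma hg_term_Suc:
  "hg_term a (Suc k) = hg_term a k
     * ((a + of_nat k) * (1/2 - a + of_nat k) / ((3 * a + of_nat k) * (2 * (1 + of_nat k))))"
  unfolding hg_term_def pochhammer_Suc by (simp add: mult_ac del: distrib_left_numeral distrib_right_numeral)

text \<open>
  The ratio of consecutive terms tends to \<open>1/2\<close>. Any bound below \<open>1\<close> that is uniform for \<open>a\<close> in a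
  disc makes the series converge locally uniformly; the threshold for \<open>k\<close> is generous.
\<close>

lemma hg_term_ratio_bound:
  fixes a :: complex
  assumes R: "norm a \<le> R" and k: "20 * (R + 1) \<le> real k"
  shows "norm ((a + of_nat k) * (1/2 - a + of_nat k) / ((3 * a + of_nat k) * (2 * (1 + of_nat k)))) \<le> 3/4"
proof -
  have R0: "R \<ge> 0" using R norm_ge_zero[of a] by linarith
  define x where "x = real k"
  have x: "20 * R + 20 \<le> x" using k by (simp add: x_def)
  have 1: "norm (a + of_nat k) \<le> x + R"
    using norm_triangle_ineq[of a "of_nat k"] R by (simp add: x_def)
  have 2: "norm (1/2 - a + of_nat k) \<le> x + R + 1"
    using norm_triangle_ineq[of "1/2 - a" "of_nat k"] norm_triangle_ineq4[of "1/2" a] R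
    by (simp add: x_def)
  have 3: "norm (3 * a + of_nat k) \<ge> x - 3 * R"
    using norm_diff_ineq[of "of_nat k" "3 * a"] R by (simp add: x_def norm_mult add.commute)
  have 4: "norm (2 * (1 + of_nat k) :: complex) = 2 * (1 + x)"
    unfolding norm_mult using norm_of_nat[of "1 + k", where 'a = complex] by (simp add: x_def)
  have pos: "x - 3 * R > 0" "x > 0" using x R0 by linarith+
  have "20 * R * (7 * R + 21) \<le> x * (x + 1 - 13 * R)"
    using x R0 by (intro mult_mono) auto
  moreover have "20 * R * (7 * R + 21) = 140 * (R * R) + 420 * R" by (simp add: algebra_simps)
  moreover have "0 \<le> R * R" using R0 by simp
  ultimately have "0 \<le> x * (x + 1 - 13 * R) - 2 * (R * R) - 11 * R"
    using R0 by linarith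
  then have main: "(x + R) * (x + R + 1) \<le> 3/4 * ((x - 3 * R) * (2 * (1 + x)))"
    by (simp add: algebra_simps)
  have "norm ((a + of_nat k) * (1/2 - a + of_nat k)) \<le> (x + R) * (x + R + 1)"
    unfolding norm_mult using 1 2 pos R0 by (intro mult_mono) auto
  also note main
  also have "3/4 * ((x - 3 * R) * (2 * (1 + x)))
      \<le> 3/4 * norm ((3 * a + of_nat k) * (2 * (1 + of_nat k)))"
    unfolding norm_mult[of "3 * a + of_nat k"] 4 using 3 pos
    by (intro mult_left_mono mult_right_mono) auto
  finally have *: "norm ((a + of_nat k) * (1/2 - a + of_nat k))
      \<le> 3/4 * norm ((3 * a + of_nat k) * (2 * (1 + of_nat k)))" .
  have "norm ((3 * a + of_nat k) * (2 * (1 + of_nat k))) > 0"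
    unfolding norm_mult[of "3 * a + of_nat k"] 4 using 3 pos by (intro mult_pos_pos) auto
  then show ?thesis unfolding norm_divide using * by (subst pos_divide_le_eq)
qed

definition hg_dom :: "complex set" where "hg_dom = {a. 3 * a \<notin> \<int>\<^sub>\<le>\<^sub>0}"

lemma hg_dom_alt: "hg_dom = - (\<lambda>x. x / 3) ` \<int>\<^sub>\<le>\<^sub>0"
proof -
  have "3 * a \<in> \<int>\<^sub>\<le>\<^sub>0 \<longleftrightarrow> a \<in> (\<lambda>x. x / 3) ` \<int>\<^sub>\<le>\<^sub>0" for a :: complex
    by (auto intro: image_eqI[of _ _ "3 * a"])
  then show ?thesis by (auto simp: hg_dom_def)
qed

lemma open_hg_dom: "open hg_dom"
proof -
  have "open ((\<lambda>a. 3 * a) -` (- \<int>\<^sub>\<le>\<^sub>0) :: complex set)"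
    by (intro open_vimage continuous_intros) auto
  also have "(\<lambda>a. 3 * a) -` (- \<int>\<^sub>\<le>\<^sub>0) = hg_dom" by (auto simp: hg_dom_def)
  finally show ?thesis .
qed

lemma connected_hg_dom: "connected hg_dom"
proof -
  have "countable (\<int>\<^sub>\<le>\<^sub>0 :: complex set)"
    by (rule countable_subset[of _ "range of_int"]) (auto elim!: nonpos_Ints_cases)
  then have "connected (UNIV - (\<lambda>x. x / 3) ` (\<int>\<^sub>\<le>\<^sub>0 :: complex set))"
    by (intro connected_open_diff_countable) (auto simp: connected_UNIV)
  then show ?thesis by (simp add: hg_dom_alt Compl_eq_Diff_UNIV)
qed

lemma holomorphic_hg_term: "(\<lambda>a. hg_term a k) holomorphic_on hg_dom"
proof -
  have "pochhammer (3 * a) k \<noteq> 0" if "a \<in> hg_dom" for a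
    using that pochhammer_eq_0_imp_nonpos_Int[of "3 * a" k] by (auto simp: hg_dom_def)
  then show ?thesis
    unfolding hg_term_def pochhammer_prod
    by (intro holomorphic_intros) auto
qed

lemma hg_series_uniform:
  assumes "cball z d \<subseteq> hg_dom" "d > 0"
  shows "uniform_limit (cball z d) (\<lambda>n a. \<Sum>k<n. hg_term a k) (\<lambda>a. \<Sum>k. hg_term a k) sequentially"
proof -
  define R where "R = norm z + d"
  \<comment> \<open>From index \<open>N\<close> on, the terms decay geometrically at a rate that is independent of \<open>a\<close>.\<close>
  define N where "N = nat \<lceil>20 * (R + 1)\<rceil>"
  have R: "norm a \<le> R" if "a \<in> cball z d" for a
    using that norm_triangle_ineq2[of a z] by (simp add: R_def dist_norm norm_minus_commute)
  have "continuous_on (cball z d) (\<lambda>a. hg_term a N)"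
    by (rule continuous_on_subset[OF holomorphic_on_imp_continuous_on[OF holomorphic_hg_term] assms(1)])
  from this have "bounded ((\<lambda>a. hg_term a N) ` cball z d)"
    by (intro compact_imp_bounded compact_continuous_image compact_cball)
  then obtain M where M: "\<forall>a\<in>cball z d. norm (hg_term a N) \<le> M"
    unfolding bounded_iff by auto
  have bd: "norm (hg_term a (j + N)) \<le> M * (3/4) ^ j" if a: "a \<in> cball z d" for a j
  proof (induction j)
    case (Suc j)
    have "20 * (R + 1) \<le> real (j + N)" unfolding N_def by linarith
    from hg_term_ratio_bound[OF R[OF a] this]
    have "norm (hg_term a (Suc (j + N))) \<le> norm (hg_term a (j + N)) * (3/4)"
      unfolding hg_term_Suc[of a "j + N"] norm_mult[of "hg_term a (j + N)"]
      by (intro mult_left_mono) auto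
    also have "\<dots> \<le> M * (3/4) ^ j * (3/4)" using Suc.IH by (intro mult_right_mono) auto
    finally show ?case by simp
  next
    case 0
    show ?case using bspec[OF M a] by simp
  qed
  have "eventually (\<lambda>n. \<forall>a\<in>cball z d. norm (hg_term a n) \<le> M * (3/4) ^ (n - N)) sequentially"
    using eventually_ge_at_top[of N]
  proof eventually_elim
    case (elim n)
    show ?case using bd[of _ "n - N"] unfolding le_add_diff_inverse2[OF elim] by blast
  qed
  moreover have "summable (\<lambda>n. M * (3/4 :: real) ^ (n - N))"
  proof -
    have "summable (\<lambda>n. M * (3/4 :: real) ^ n)" by (intro summable_mult summable_geometric) simp
    then have "summable (\<lambda>n. M * (3/4 :: real) ^ (n + N - N))" by simp
    then show ?thesis by (simp only: summable_iff_shift[of "\<lambda>n. M * (3/4 :: real) ^ (n - N)" N])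
  qed
  ultimately show ?thesis by (rule Weierstrass_m_test_ev)
qed

lemma holomorphic_hg_series: "(\<lambda>a. \<Sum>k. hg_term a k) holomorphic_on hg_dom"
proof (rule holomorphic_uniform_sequence[OF open_hg_dom])
  show "(\<lambda>a. \<Sum>k<n. hg_term a k) holomorphic_on hg_dom" for n
    by (intro holomorphic_intros holomorphic_hg_term)
  show "\<exists>d>0. cball x d \<subseteq> hg_dom \<and> uniform_limit (cball x d)
      (\<lambda>n a. \<Sum>k<n. hg_term a k) (\<lambda>a. \<Sum>k. hg_term a k) sequentially" if x: "x \<in> hg_dom" for x
  proof -
    obtain d where "d > 0" "cball x d \<subseteq> hg_dom"
      using bspec[OF open_hg_dom[unfolded open_contains_cball] x] by auto
    then show ?thesis by (intro exI[of _ d] conjI hg_series_uniform)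
  qed
qed

section \<open>The recurrence for the series\<close>

lemma summable_hg_term:
  fixes a :: real
  assumes "a > 0"
  shows "summable (hg_term a)"
proof -
  have "complex_of_real a \<in> hg_dom"
  proof -
    have "3 * complex_of_real a = of_real (3 * a)" by simp
    then show ?thesis
      unfolding hg_dom_def mem_Collect_eq using assms
      by (simp only: of_real_in_nonpos_Ints_iff) (auto elim!: nonpos_Ints_cases)
  qed
  from bspec[OF open_hg_dom[unfolded open_contains_cball] this]
  obtain d where d: "d > 0" "cball (complex_of_real a) d \<subseteq> hg_dom" by auto
  have "(\<lambda>n. \<Sum>k<n. hg_term (complex_of_real a) k) \<longlonglongrightarrow> (\<Sum>k. hg_term (complex_of_real a) k)"
    using tendsto_uniform_limitI[OF hg_series_uniform[OF d(2,1)], of "complex_of_real a"] d by simp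
  then have "(\<lambda>k. complex_of_real (hg_term a k)) sums (\<Sum>k. hg_term (complex_of_real a) k)"
    unfolding hg_term_of_real sums_def .
  then have "summable (\<lambda>k. complex_of_real (hg_term a k))" by (rule sums_summable)
  then show ?thesis by simp
qed

text \<open>
  Summing the telescoping identity. No boundary term survives at infinity because the certificate is
  the general term times a rational function of \<open>k\<close> that is bounded for large \<open>k\<close>.
\<close>

lemma hg_series_step:
  fixes a :: real
  assumes a: "a > 0"
  shows "(8 * a + 3) * (8 * a + 5) * (\<Sum>k. hg_term (a + 1) k)
         = 6 * (3 * a + 1) * (3 * a + 2) * (\<Sum>k. hg_term a k)"
proof -
  define c where "c = 6 * (3 * a + 1) * (3 * a + 2)"
  have lim: "wz_cert a \<longlonglongrightarrow> 0"
  proof -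
    have t0: "hg_term a \<longlonglongrightarrow> 0" using summable_LIMSEQ_zero[OF summable_hg_term[OF a]] .
    have "(\<lambda>k. real k * (2 * real k ^ 2 + 4 * a * real k + 10 * a ^ 2 + 6 * a + 1)
        / ((real k - 1/2 - a) * (3 * a + real k) * (3 * a + real k + 1))) \<longlonglongrightarrow> 2"
      by real_asymp
    then have "(\<lambda>k. c * hg_term a k * (real k * (2 * real k ^ 2 + 4 * a * real k + 10 * a ^ 2 + 6 * a + 1)
        / ((real k - 1/2 - a) * (3 * a + real k) * (3 * a + real k + 1)))) \<longlonglongrightarrow> c * 0 * 2"
      by (intro tendsto_intros t0)
    moreover have "eventually (\<lambda>k. c * hg_term a k * (real k * (2 * real k ^ 2 + 4 * a * real k + 10 * a ^ 2 + 6 * a + 1)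
        / ((real k - 1/2 - a) * (3 * a + real k) * (3 * a + real k + 1))) = wz_cert a k) sequentially"
      using eventually_gt_at_top[of "Suc (nat \<lceil>a + 1/2\<rceil>)"]
    proof eventually_elim
      case (elim k)
      then obtain j where j: "k = Suc j" by (cases k) auto
      have "real k > a + 1/2" using elim by linarith
      then have nz: "real k - 1/2 - a \<noteq> 0" by simp
      have "pochhammer (1/2 - a) k = pochhammer (1/2 - a) (k - 1) * (real k - 1/2 - a)"
        unfolding j by (simp add: pochhammer_Suc)
      moreover have "pochhammer (3 * a) (k + 2) = pochhammer (3 * a) k * ((3 * a + real k) * (3 * a + real k + 1))"
        by (simp add: pochhammer_Suc eval_nat_numeral algebra_simps)
      ultimately show ?case
        unfolding hg_term_def wz_cert_def c_def using nz by (simp add: mult_ac)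
    qed
    ultimately have "wz_cert a \<longlonglongrightarrow> c * 0 * 2" by (rule Lim_transform_eventually)
    then show ?thesis by simp
  qed
  have "(\<lambda>k. wz_cert a (Suc k) - wz_cert a k) sums (0 - wz_cert a 0)"
    by (rule telescope_sums[OF lim])
  moreover have "wz_cert a (Suc k) - wz_cert a k
     = (8 * a + 3) * (8 * a + 5) * hg_term (a + 1) k - c * hg_term a k" for k
    using wz_identity[of a k] pochhammer_pos[of "3 * a" "k + 3"] a by (simp add: c_def)
  ultimately have 1: "(\<lambda>k. (8 * a + 3) * (8 * a + 5) * hg_term (a + 1) k - c * hg_term a k) sums 0"
    by (simp add: wz_cert_def)
  have 2: "(\<lambda>k. (8 * a + 3) * (8 * a + 5) * hg_term (a + 1) k - c * hg_term a k) sums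
     ((8 * a + 3) * (8 * a + 5) * (\<Sum>k. hg_term (a + 1) k) - c * (\<Sum>k. hg_term a k))"
    using a by (intro sums_diff sums_mult summable_sums summable_hg_term) auto
  from sums_unique2[OF 1 2] show ?thesis by (simp add: c_def)
qed

section \<open>Asymptotics from Euler's integral\<close>

text \<open>
  The substitution \<open>t = s\<^sup>2\<close> in the Beta integral.
\<close>

lemma has_integral_Beta_square:
  fixes a :: real
  assumes "a > 1"
  shows "((\<lambda>s. s powr (2 * a - 1) * (1 - s\<^sup>2) powr (a - 1)) has_integral Beta a a / 2) {0..1}"
proof -
  define f where "f t = t powr (a - 1) * (1 - t) powr (a - 1)" for t :: real
  have "(f has_integral Beta a a) {0..1}"
    unfolding f_def using assms by (intro has_integral_Beta_real) auto
  then have If: "integral {0..1} f = Beta a a" by (rule integral_unique)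
  have cont: "continuous_on {0..1} f"
    unfolding f_def using assms by (intro continuous_intros continuous_on_powr') auto
  have "((\<lambda>s. (2 * s) *\<^sub>R f (s\<^sup>2)) has_integral integral {0\<^sup>2..1\<^sup>2} f) {0..1}"
    by (rule has_integral_substitution[where c = 0 and d = 1])
       (use cont in \<open>auto intro!: derivative_eq_intros simp: power_le_one\<close>)
  then have "((\<lambda>s. 2 * s * f (s\<^sup>2)) has_integral Beta a a) {0..1}" using If by simp
  from has_integral_divide[OF this, of 2]
  have "((\<lambda>s. 2 * s * f (s\<^sup>2) / 2) has_integral Beta a a / 2) {0..1}" .
  moreover have "2 * s * f (s\<^sup>2) / 2 = s powr (2 * a - 1) * (1 - s\<^sup>2) powr (a - 1)"
    if "s \<in> {0..1}" for s
  proof (cases "s = 0")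
    case False
    then have s: "s > 0" using that by simp
    have "(s\<^sup>2) powr (a - 1) = s powr (2 * (a - 1))"
      using s by (simp flip: powr_numeral add: powr_powr)
    then have "s * (s\<^sup>2) powr (a - 1) = s powr (2 * a - 1)"
      using s by (simp add: powr_mult_base)
    then show ?thesis by (simp add: f_def)
  qed (simp add: f_def)
  ultimately show ?thesis by (rule has_integral_eq[rotated])
qed

lemma summable_abs_pochhammer_half:
  fixes a :: real
  shows "summable (\<lambda>k. \<bar>pochhammer (1/2 - a) k / (fact k * 2 ^ k)\<bar>)"
proof -
  have "ereal (norm (1/2 :: real)) < conv_radius (\<lambda>n. (a - 1/2) gchoose n)"
    by (simp add: conv_radius_gchoose)
  from abs_summable_in_conv_radius[OF this] show ?thesis
    by (simp add: gbinomial_pochhammer abs_mult power_divide minus_diff_eq)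
qed

lemma Beta_add_nat:
  fixes a b :: real
  assumes "a > 0" "b > 0"
  shows "Beta b (a + of_nat k) = Beta b a * pochhammer a k / pochhammer (a + b) k"
  using assms by (simp add: Beta_def pochhammer_Gamma pos_notin_nonpos_Ints Gamma_eq_zero_iff add_ac)

text \<open>
  Euler's integral for \<open>F(a, 1/2 - a; 3a; 1/2)\<close>, with \<open>s = 1 - t\<close> in place of the usual variable. The
  condition \<open>a > 1\<close> (rather than \<open>a > 0\<close>) makes the weight continuous on the closed interval, so the
  binomial series can be integrated term by term by uniform convergence.
\<close>

lemma hg_series_Euler_integral:
  fixes a :: real
  assumes a: "a > 1"
  shows "((\<lambda>s. s powr (2 * a - 1) * (1 - s) powr (a - 1) * ((1 + s) / 2) powr (a - 1/2))
    has_integral Beta (2 * a) a * (\<Sum>k. hg_term a k)) {0..1}"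
proof -
  define w where "w s = s powr (2 * a - 1) * (1 - s) powr (a - 1)" for s :: real
  define c where "c k = pochhammer (1/2 - a) k / (fact k * 2 ^ k)" for k
  have cw: "continuous_on {0..1} w"
    unfolding w_def using a by (intro continuous_intros continuous_on_powr') auto
  have w1: "\<bar>w s\<bar> \<le> 1" if "s \<in> {0..1}" for s
    unfolding w_def abs_mult using that a by (intro mult_le_one) (auto intro!: powr_le1)
  have "uniform_limit {0..1} (\<lambda>n s. \<Sum>k<n. c k * (w s * (1 - s) ^ k))
      (\<lambda>s. \<Sum>k. c k * (w s * (1 - s) ^ k)) sequentially"
  proof (rule Weierstrass_m_test)
    show "norm (c k * (w s * (1 - s) ^ k)) \<le> \<bar>c k\<bar>" if "s \<in> {0..1}" for k s
    proof -
      have "\<bar>w s\<bar> * \<bar>1 - s\<bar> ^ k \<le> 1"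
        using w1[OF that] that by (intro mult_le_one power_le_one) auto
      then have "\<bar>c k\<bar> * (\<bar>w s\<bar> * \<bar>1 - s\<bar> ^ k) \<le> \<bar>c k\<bar> * 1"
        by (intro mult_left_mono) auto
      then show ?thesis by (simp add: abs_mult power_abs)
    qed
    show "summable (\<lambda>k. \<bar>c k\<bar>)" unfolding c_def by (rule summable_abs_pochhammer_half)
  qed
  moreover have "continuous_on {0..1} (\<lambda>s. \<Sum>k<n. c k * (w s * (1 - s) ^ k))" for n
    by (intro continuous_intros cw)
  ultimately obtain I J where I: "\<And>n. ((\<lambda>s. \<Sum>k<n. c k * (w s * (1 - s) ^ k)) has_integral I n) {0..1}"
    and J: "((\<lambda>s. \<Sum>k. c k * (w s * (1 - s) ^ k)) has_integral J) {0..1}" and IJ: "I \<longlonglongrightarrow> J"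
    by (rule uniform_limit_integral) auto
  have "I n = (\<Sum>k<n. Beta (2 * a) a * hg_term a k)" for n
  proof -
    have "((\<lambda>s. \<Sum>k<n. c k * (w s * (1 - s) ^ k)) has_integral (\<Sum>k<n. c k * Beta (2 * a) (a + of_nat k))) {0..1}"
    proof (intro has_integral_sum has_integral_mult_right)
      fix k
      have "((\<lambda>s. s powr (2 * a - 1) * (1 - s) powr (a + of_nat k - 1)) has_integral Beta (2 * a) (a + of_nat k)) {0..1}"
        using a by (intro has_integral_Beta_real) auto
      moreover have "s powr (2 * a - 1) * (1 - s) powr (a + of_nat k - 1) = w s * (1 - s) ^ k"
        if "s \<in> {0..1}" for s
      proof (cases "s = 1")
        case True
        then show ?thesis by (simp add: w_def)
      next
        case False
        then have "1 - s > 0" using that by simp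
        then have "(1 - s) powr (a + of_nat k - 1) = (1 - s) powr (a - 1) * (1 - s) ^ k"
          by (simp add: powr_add[symmetric] powr_realpow[symmetric] algebra_simps)
        then show ?thesis by (simp add: w_def)
      qed
      ultimately show "((\<lambda>s. w s * (1 - s) ^ k) has_integral Beta (2 * a) (a + of_nat k)) {0..1}"
        by (rule has_integral_eq[rotated])
    qed auto
    from has_integral_unique[OF I this] show ?thesis
      using a by (simp add: Beta_add_nat c_def hg_term_def mult_ac)
  qed
  then have I': "I = (\<lambda>n. \<Sum>k<n. Beta (2 * a) a * hg_term a k)" by (rule ext)
  have "I \<longlonglongrightarrow> Beta (2 * a) a * (\<Sum>k. hg_term a k)"
    using sums_mult[OF summable_sums[OF summable_hg_term], of a "Beta (2 * a) a"] a
    by (simp add: sums_def I')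
  with IJ have "J = Beta (2 * a) a * (\<Sum>k. hg_term a k)" by (rule LIMSEQ_unique)
  moreover have "(\<Sum>k. c k * (w s * (1 - s) ^ k)) = w s * ((1 + s) / 2) powr (a - 1/2)"
    if s: "s \<in> {0..1}" for s
  proof -
    have "\<bar>- ((1 - s) / 2)\<bar> < 1" using s by simp
    note gen_binomial_real[OF this, of "a - 1/2"]
    moreover have "1 + - ((1 - s) / 2) = (1 + s) / 2" by (simp add: field_simps)
    moreover have "((a - 1/2) gchoose k) * (- ((1 - s) / 2)) ^ k = c k * (1 - s) ^ k" for k
      by (simp add: c_def gbinomial_pochhammer power_minus[of "(1 - s) / 2"] power_divide)
    ultimately have "(\<lambda>k. c k * (1 - s) ^ k) sums ((1 + s) / 2) powr (a - 1/2)"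
      by (simp only:)
    from sums_unique[OF sums_mult[OF this, of "w s"]] show ?thesis by (simp add: mult_ac)
  qed
  ultimately show ?thesis using J unfolding w_def by (auto intro: has_integral_eq[rotated])
qed

text \<open>
  The function \<open>sqrt (1 + s)\<close> is close to its value at the saddle point \<open>s\<^sup>2 = 1/2\<close>. The inequality of
  the arithmetic and geometric means turns the Lipschitz bound into one that is quadratic in
  \<open>s\<^sup>2 - 1/2\<close>; a polynomial in \<open>s\<^sup>2\<close> can be integrated exactly against the weight.
\<close>

lemma sqrt_one_plus_bound:
  fixes s :: real
  assumes "0 \<le> s" "e > 0"
  shows "\<bar>sqrt (1 + s) - sqrt (1 + sqrt (1/2))\<bar> \<le> e + (s\<^sup>2 - 1/2)\<^sup>2 / e"
proof -
  define v where "v = sqrt (1/2 :: real)"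
  have v: "v > 0" "v\<^sup>2 = 1/2" by (simp_all add: v_def)
  have "(1/2)\<^sup>2 \<le> v\<^sup>2" unfolding v(2) by (simp add: power2_eq_square)
  then have v2: "1/2 \<le> v" using v(1) by (rule_tac power2_le_imp_le) auto
  have 1: "1 \<le> sqrt (1 + s)" "1 \<le> sqrt (1 + v)" using assms v by auto
  have "(sqrt (1 + s) - sqrt (1 + v)) * (sqrt (1 + s) + sqrt (1 + v)) = s - v"
    using assms v by (simp add: algebra_simps)
  then have "\<bar>sqrt (1 + s) - sqrt (1 + v)\<bar> * (sqrt (1 + s) + sqrt (1 + v)) = \<bar>s - v\<bar>"
    using 1 by (metis abs_mult abs_of_nonneg add_nonneg_nonneg order_trans zero_le_one)
  moreover have "\<bar>sqrt (1 + s) - sqrt (1 + v)\<bar> * 2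
      \<le> \<bar>sqrt (1 + s) - sqrt (1 + v)\<bar> * (sqrt (1 + s) + sqrt (1 + v))"
    using 1 by (intro mult_left_mono abs_ge_zero) linarith
  ultimately have 2: "\<bar>sqrt (1 + s) - sqrt (1 + v)\<bar> * 2 \<le> \<bar>s - v\<bar>" by simp
  have "s\<^sup>2 - 1/2 = (s - v) * (s + v)" using v by (simp add: algebra_simps power2_eq_square)
  then have "\<bar>s\<^sup>2 - 1/2\<bar> = \<bar>s - v\<bar> * (s + v)" using assms v by (simp add: abs_mult)
  moreover have "\<bar>s - v\<bar> * (1/2) \<le> \<bar>s - v\<bar> * (s + v)"
    using assms v2 by (intro mult_left_mono) auto
  ultimately have "\<bar>s - v\<bar> * (1/2) \<le> \<bar>s\<^sup>2 - 1/2\<bar>" by simp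
  moreover have "\<bar>sqrt (1 + s) - sqrt (1 + v)\<bar> \<le> \<bar>s - v\<bar> * (1/2)" using 2 by simp
  ultimately have 3: "\<bar>sqrt (1 + s) - sqrt (1 + v)\<bar> \<le> \<bar>s\<^sup>2 - 1/2\<bar>" by (rule order_trans[rotated])
  define x where "x = \<bar>s\<^sup>2 - 1/2\<bar>"
  have "0 \<le> (x - e)\<^sup>2 / e" using assms by simp
  also have "(x - e)\<^sup>2 / e = e + x\<^sup>2 / e - 2 * x"
    using assms by (simp add: power2_eq_square field_simps)
  finally have "0 \<le> e + x\<^sup>2 / e - 2 * x" .
  moreover have "0 \<le> x" by (simp add: x_def)
  ultimately have "x \<le> e + x\<^sup>2 / e" by linarith
  with 3 show ?thesis by (simp add: x_def v_def)
qed

text \<open>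
  The saddle point estimate. In the variable \<open>s\<close> the integrand of Euler's integral is, up to a
  constant factor, the Beta weight \<open>s powr (2a - 1) * (1 - s\<^sup>2) powr (a - 1)\<close> times \<open>sqrt (1 + s)\<close>. Under
  the normalised weight, \<open>s\<^sup>2\<close> has mean \<open>1/2\<close> and variance \<open>1 / (4 * (2a + 1))\<close>, so \<open>sqrt (1 + s)\<close> may
  be replaced by its value at \<open>s\<^sup>2 = 1/2\<close>.
\<close>

lemma hg_series_concentration:
  fixes a :: real
  assumes a: "a > 1" and e: "e > 0"
  shows "\<bar>2 powr (a - 1/2) * Beta (2 * a) a * (\<Sum>k. hg_term a k) / (Beta a a / 2)
           - sqrt (1 + sqrt (1/2))\<bar> \<le> e + 1 / (e * (4 * (2 * a + 1)))"
proof -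
  define h where "h s = s powr (2 * a - 1) * (1 - s\<^sup>2) powr (a - 1)" for s :: real
  define J where "J = Beta a a / 2"
  define C where "C = sqrt (1 + sqrt (1/2 :: real))"
  define I where "I = 2 powr (a - 1/2) * (Beta (2 * a) a * (\<Sum>k. hg_term a k))"
  have Jpos: "J > 0" using a by (auto simp: J_def Beta_def)
  have h0: "h s \<ge> 0" for s by (simp add: h_def)
  have hJ: "(h has_integral J) {0..1}"
    unfolding h_def J_def by (rule has_integral_Beta_square[OF a])
  have hI: "((\<lambda>s. h s * sqrt (1 + s)) has_integral I) {0..1}"
  proof -
    have "((\<lambda>s. 2 powr (a - 1/2) * (s powr (2 * a - 1) * (1 - s) powr (a - 1) * ((1 + s) / 2) powr (a - 1/2)))
      has_integral I) {0..1}"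
      unfolding I_def by (intro has_integral_mult_right hg_series_Euler_integral a)
    moreover have "2 powr (a - 1/2) * (s powr (2 * a - 1) * (1 - s) powr (a - 1) * ((1 + s) / 2) powr (a - 1/2))
        = h s * sqrt (1 + s)" if s: "s \<in> {0..1}" for s
    proof -
      have "(1 + s) powr (a - 1/2) = (1 + s) powr (a - 1) * sqrt (1 + s)"
        using s by (simp add: powr_half_sqrt[symmetric] powr_add[symmetric])
      moreover have "(1 - s\<^sup>2) powr (a - 1) = (1 - s) powr (a - 1) * (1 + s) powr (a - 1)"
        using s by (subst powr_mult[symmetric]) (auto simp: power2_eq_square algebra_simps)
      ultimately show ?thesis using s by (simp add: h_def powr_divide)
    qed
    ultimately show ?thesis by (rule has_integral_eq[rotated])
  qed
  have h2: "((\<lambda>s. (s\<^sup>2 - 1/2)\<^sup>2 * h s) has_integral J / (4 * (2 * a + 1))) {0..1}"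
  proof -
    \<comment> \<open>The weight for \<open>a + 1\<close> is \<open>s\<^sup>2 * (1 - s\<^sup>2) * h s\<close>, and \<open>(s\<^sup>2 - 1/2)\<^sup>2 = 1/4 - s\<^sup>2 * (1 - s\<^sup>2)\<close>.\<close>
    define h' where "h' s = s powr (2 * (a + 1) - 1) * (1 - s\<^sup>2) powr (a + 1 - 1)" for s :: real
    have J': "(h' has_integral Beta (a + 1) (a + 1) / 2) {0..1}"
      unfolding h'_def using a by (intro has_integral_Beta_square) auto
    have "Beta (a + 1) (a + 1) / 2 = J * (a / (2 * (2 * a + 1)))"
    proof -
      have G: "Gamma (a + 1) = a * Gamma a" using a by (simp add: Gamma_plus1 pos_notin_nonpos_Ints)
      have "Gamma (2 * a + 1 + 1) = (2 * a + 1) * (2 * a * Gamma (2 * a))"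
        using a Gamma_plus1[of "2 * a + 1"] Gamma_plus1[of "2 * a"]
        by (simp add: pos_notin_nonpos_Ints)
      moreover have "a + 1 + (a + 1) = 2 * a + 1 + 1" "a + a = 2 * a" by simp_all
      ultimately show ?thesis unfolding J_def Beta_def G using a by (simp only:) (simp add: divide_simps)
    qed
    with J' have J'': "(h' has_integral J * (a / (2 * (2 * a + 1)))) {0..1}" by simp
    have "((\<lambda>s. 1/4 * h s - h' s) has_integral 1/4 * J - J * (a / (2 * (2 * a + 1)))) {0..1}"
      by (intro has_integral_diff has_integral_mult_right hJ J'')
    also have "1/4 * J - J * (a / (2 * (2 * a + 1))) = J / (4 * (2 * a + 1))"
      using a by (simp add: field_simps)
    finally have "((\<lambda>s. 1/4 * h s - h' s) has_integral J / (4 * (2 * a + 1))) {0..1}" .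
    moreover have "1/4 * h s - h' s = (s\<^sup>2 - 1/2)\<^sup>2 * h s" if s: "s \<in> {0..1}" for s
    proof -
      have "s powr (2 * (a + 1) - 1) = s\<^sup>2 * s powr (2 * a - 1)"
        using s a by (cases "s = 0") (auto simp: powr_add[symmetric] powr_numeral[symmetric] algebra_simps simp del: powr_numeral)
      moreover have "(1 - s\<^sup>2) powr (a + 1 - 1) = (1 - s\<^sup>2) * (1 - s\<^sup>2) powr (a - 1)"
        using s by (simp add: powr_mult_base power_le_one)
      ultimately have "h' s = s\<^sup>2 * (1 - s\<^sup>2) * h s" by (simp add: h_def h'_def)
      then show ?thesis by (simp add: power2_eq_square algebra_simps)
    qed
    ultimately show ?thesis by (rule has_integral_eq[rotated])
  qed
  define B where "B = e * J + J / (4 * (2 * a + 1)) / e"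
  have hB: "((\<lambda>s. e * h s + (s\<^sup>2 - 1/2)\<^sup>2 * h s / e) has_integral B) {0..1}"
    unfolding B_def by (intro has_integral_add has_integral_mult_right has_integral_divide hJ h2)
  have hD: "((\<lambda>s. h s * sqrt (1 + s) - C * h s) has_integral I - C * J) {0..1}"
    by (intro has_integral_diff has_integral_mult_right hI hJ)
  have pt: "\<bar>h s * sqrt (1 + s) - C * h s\<bar> \<le> e * h s + (s\<^sup>2 - 1/2)\<^sup>2 * h s / e" if "s \<in> {0..1}" for s
  proof -
    have "\<bar>h s * sqrt (1 + s) - C * h s\<bar> = h s * \<bar>sqrt (1 + s) - C\<bar>"
      using h0[of s] by (simp add: abs_mult[symmetric] abs_of_nonneg flip: right_diff_distrib add: mult.commute[of C])
         (simp add: abs_mult)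
    also have "\<dots> \<le> h s * (e + (s\<^sup>2 - 1/2)\<^sup>2 / e)"
      unfolding C_def using that e h0 by (intro mult_left_mono sqrt_one_plus_bound) auto
    finally show ?thesis by (simp add: algebra_simps)
  qed
  have "\<bar>I - C * J\<bar> \<le> B"
    using has_integral_norm_bound_integral_component[OF hD hB, of 1] pt by simp
  then have "\<bar>I - C * J\<bar> / J \<le> B / J" using Jpos by (intro divide_right_mono) auto
  also have "B / J = e + 1 / (e * (4 * (2 * a + 1)))"
    using Jpos by (simp add: B_def add_divide_distrib)
  also have "\<bar>I - C * J\<bar> / J = \<bar>I / J - C\<bar>"
  proof -
    have "I / J - C = (I - C * J) / J" using Jpos by (simp add: field_simps)
    then show ?thesis using Jpos by (simp add: abs_divide)
  qed
  finally show ?thesis by (simp add: I_def J_def C_def mult_ac)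
qed

text \<open>
  The quotient \<open>Q\<close> of the series and the Gamma quotient is unchanged by \<open>a \<mapsto> a + 1\<close>, hence equal to
  its limit along \<open>a + n\<close>. The quantity \<open>L\<close> is the one estimated above; the duplication and
  triplication formulas show that \<open>Q\<close> and \<open>L\<close> differ by \<open>sqrt 2 / sqrt 3\<close> and a ratio of Gamma values
  that tends to \<open>1\<close>.
\<close>

lemma hg_series_closed_form_real:
  fixes a :: real
  assumes a: "a > 1"
  shows "(\<Sum>k. hg_term a k) = 2 * cos (pi / 8) / sqrt 3 * (3 powr (3 * a) / 2 powr (5 * a))
     * (Gamma (a + 1/3) * Gamma (a + 2/3)) / (Gamma (a + 3/8) * Gamma (a + 5/8))"
proof -
  define F where "F x = (\<Sum>k. hg_term x k)" for x :: real
  define C where "C = sqrt (1 + sqrt (1/2 :: real))"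
  define L where "L x = 2 powr (x - 1/2) * Beta (2 * x) x * F x / (Beta x x / 2)" for x :: real
  define Q where "Q x = F x * (2 powr (5 * x) / 3 powr (3 * x)) * (Gamma (x + 3/8) * Gamma (x + 5/8))
     / (Gamma (x + 1/3) * Gamma (x + 2/3))" for x :: real
  have Gp: "Gamma x > 0" if "x > 0" for x :: real using that by simp
  have Q_Suc: "Q (x + 1) = Q x" if x: "x > 0" for x
  proof -
    have G: "Gamma (x + 1 + c) = (x + c) * Gamma (x + c)" if "c > 0" for c
      using Gamma_plus1[of "x + c"] that x by (simp add: pos_notin_nonpos_Ints add_ac)
    have F: "F (x + 1) = 6 * (3 * x + 1) * (3 * x + 2) * F x / ((8 * x + 3) * (8 * x + 5))"
      using hg_series_step[OF x] x unfolding F_def by (simp add: nonzero_eq_divide_eq mult_ac)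
    have p: "(2::real) powr (5 * (x + 1)) = 32 * 2 powr (5 * x)"
      "(3::real) powr (3 * (x + 1)) = 27 * 3 powr (3 * x)"
      by (simp_all add: powr_add distrib_left)
    have Gs: "Gamma (x + 1 + 3/8) = (8 * x + 3) / 8 * Gamma (x + 3/8)"
      "Gamma (x + 1 + 5/8) = (8 * x + 5) / 8 * Gamma (x + 5/8)"
      "Gamma (x + 1 + 1/3) = (3 * x + 1) / 3 * Gamma (x + 1/3)"
      "Gamma (x + 1 + 2/3) = (3 * x + 2) / 3 * Gamma (x + 2/3)"
      by (subst G; simp add: add_divide_distrib)+
    have nz: "8 * x + 3 \<noteq> 0" "8 * x + 5 \<noteq> 0" "3 * x + 1 \<noteq> 0" "3 * x + 2 \<noteq> 0" using x by simp_all
    have frac: "6 * p * q * f / (r * t) * (32 * u / (27 * v)) * ((r / 8 * g1) * (t / 8 * g2)) / ((p / 3 * g3) * (q / 3 * g4))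
        = f * (u / v) * (g1 * g2) / (g3 * g4)"
      if "p \<noteq> 0" "q \<noteq> 0" "r \<noteq> 0" "t \<noteq> 0" for p q f r t u v g1 g2 g3 g4 :: real
      using that by simp
    have "Q (x + 1) = 6 * (3 * x + 1) * (3 * x + 2) * F x / ((8 * x + 3) * (8 * x + 5))
        * (32 * 2 powr (5 * x) / (27 * 3 powr (3 * x)))
        * (((8 * x + 3) / 8 * Gamma (x + 3/8)) * ((8 * x + 5) / 8 * Gamma (x + 5/8)))
        / (((3 * x + 1) / 3 * Gamma (x + 1/3)) * ((3 * x + 2) / 3 * Gamma (x + 2/3)))"
      unfolding Q_def F p Gs ..
    also have "\<dots> = Q x" unfolding Q_def by (rule frac[OF nz(3,4,1,2)])
    finally show ?thesis .
  qed
  have Q_shift: "Q (a + of_nat n) = Q a" for n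
  proof (induction n)
    case (Suc n)
    have "Q (a + of_nat n + 1) = Q (a + of_nat n)" using a by (intro Q_Suc) linarith
    then show ?case using Suc.IH by (simp add: add_ac)
  qed simp
  have QL: "Q x = L x * (sqrt 2 / sqrt 3) * (Gamma (x + 3/8) * Gamma (x + 5/8) / Gamma (x + 1/2) ^ 2)"
    if x: "x > 0" for x
  proof -
    define A B T where "A = (2::real) powr x" and "B = (3::real) powr (3 * x)" and
      "T = Gamma (x + 1/3) * Gamma (x + 2/3)"
    have pos: "A > 0" "B > 0" "T > 0" using x by (auto simp: A_def B_def T_def)
    have G2: "Gamma (2 * x) = Gamma x * Gamma (x + 1/2) * A\<^sup>2 / (2 * sqrt pi)"
    proof -
      have "2 powr (1 - 2 * x) = 2 / A\<^sup>2"
        by (simp add: A_def powr_diff powr_power)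
      then show ?thesis using Gamma_duplication_real[OF x] pos by (simp add: field_simps)
    qed
    have G3: "Gamma (3 * x) = Gamma x * T * B / (2 * pi * sqrt 3)"
    proof -
      have "3 powr (1/2 - 3 * x) = sqrt 3 / B"
        by (simp add: B_def powr_diff powr_half_sqrt)
      then show ?thesis using Gamma_triplication_real[OF x] pos by (simp add: T_def field_simps)
    qed
    have pw: "2 powr (x - 1/2) = A / sqrt 2" "2 powr (5 * x) = A ^ 5"
      by (simp_all add: A_def powr_diff powr_half_sqrt powr_power)
    have "L x = (A / sqrt 2) * 2 * Gamma (2 * x) ^ 2 * F x / (Gamma x * Gamma (3 * x))"
      unfolding L_def pw Beta_def using x Gp[OF x] Gp[of "2 * x"] Gp[of "3 * x"]
      by (simp add: power2_eq_square field_simps)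
    also have "\<dots> = F x * A ^ 5 / B * (sqrt 3 / sqrt 2) * Gamma (x + 1/2) ^ 2 / T"
      unfolding G2 G3 using pos Gamma_eq_zero_iff[of x] pos_notin_nonpos_Ints[OF x]
      by (simp add: power2_eq_square field_simps eval_nat_numeral)
    finally have L: "L x = F x * A ^ 5 / B * (sqrt 3 / sqrt 2) * Gamma (x + 1/2) ^ 2 / T" .
    have Gh: "Gamma (x + 1/2) \<noteq> 0" using x by (simp add: Gamma_eq_zero_iff pos_notin_nonpos_Ints)
    have "Q x = F x * (A ^ 5 / B) * (Gamma (x + 3/8) * Gamma (x + 5/8)) / T"
      unfolding Q_def pw B_def[symmetric] T_def[symmetric] ..
    also have "\<dots> = L x * (sqrt 2 / sqrt 3) * (Gamma (x + 3/8) * Gamma (x + 5/8) / Gamma (x + 1/2) ^ 2)"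
      unfolding L using Gh by simp
    finally show ?thesis .
  qed
  have limL: "(\<lambda>n. L (a + of_nat n)) \<longlonglongrightarrow> C"
  proof (rule Lim_null[THEN iffD2], rule Lim_null_comparison)
    \<comment> \<open>The estimate with \<open>e = 1 / sqrt (n + 1)\<close>, which balances its two error terms.\<close>
    show "eventually (\<lambda>n. norm (L (a + of_nat n) - C) \<le>
        1 / sqrt (real n + 1) + 1 / (1 / sqrt (real n + 1) * (4 * (2 * (a + real n) + 1)))) sequentially"
    proof (intro always_eventually allI)
      fix n
      show "norm (L (a + of_nat n) - C) \<le>
        1 / sqrt (real n + 1) + 1 / (1 / sqrt (real n + 1) * (4 * (2 * (a + real n) + 1)))"
        unfolding L_def C_def F_def real_norm_def
        using a by (intro hg_series_concentration) auto
    qed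
    show "(\<lambda>n. 1 / sqrt (real n + 1) + 1 / (1 / sqrt (real n + 1) * (4 * (2 * (a + real n) + 1)))) \<longlonglongrightarrow> 0"
      by real_asymp
  qed
  define g where "g x n = Gamma (x + of_nat n) / (fact (n - 1) * of_nat n powr x)"
    for x :: real and n :: nat
  have g: "(\<lambda>n. g x n) \<longlonglongrightarrow> 1" if "x > 0" for x
    unfolding g_def by (rule Gamma_shift_asymptotics[OF that])
  have limG: "(\<lambda>n. Gamma (a + of_nat n + 3/8) * Gamma (a + of_nat n + 5/8) / Gamma (a + of_nat n + 1/2) ^ 2)
      \<longlonglongrightarrow> 1"
  proof -
    have "(\<lambda>n. g (a + 3/8) n * g (a + 5/8) n / g (a + 1/2) n ^ 2) \<longlonglongrightarrow> 1 * 1 / 1 ^ 2"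
      using a by (intro tendsto_intros g) auto
    moreover have "eventually (\<lambda>n. g (a + 3/8) n * g (a + 5/8) n / g (a + 1/2) n ^ 2 =
        Gamma (a + of_nat n + 3/8) * Gamma (a + of_nat n + 5/8) / Gamma (a + of_nat n + 1/2) ^ 2) sequentially"
      using eventually_gt_at_top[of 0]
    proof eventually_elim
      case (elim n)
      have s: "a + c + of_nat n = a + of_nat n + c" for c by simp
      have pw: "real n powr (a + 3/8) * real n powr (a + 5/8) = (real n powr (a + 1/2)) ^ 2"
        using elim by (simp add: powr_add[symmetric] power2_eq_square)
      have "g (a + 3/8) n * g (a + 5/8) n = Gamma (a + of_nat n + 3/8) * Gamma (a + of_nat n + 5/8)
          / (fact (n - 1) ^ 2 * (real n powr (a + 3/8) * real n powr (a + 5/8)))"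
        unfolding g_def s by (simp add: power2_eq_square mult_ac)
      also note pw
      finally have 1: "g (a + 3/8) n * g (a + 5/8) n
          = Gamma (a + of_nat n + 3/8) * Gamma (a + of_nat n + 5/8)
          / (fact (n - 1) ^ 2 * (real n powr (a + 1/2)) ^ 2)" .
      have 2: "g (a + 1/2) n ^ 2 = Gamma (a + of_nat n + 1/2) ^ 2
          / (fact (n - 1) ^ 2 * (real n powr (a + 1/2)) ^ 2)"
        unfolding g_def s by (simp only: power_divide power_mult_distrib)
      show ?case unfolding 1 2 using elim by simp
    qed
    ultimately have "(\<lambda>n. Gamma (a + of_nat n + 3/8) * Gamma (a + of_nat n + 5/8) / Gamma (a + of_nat n + 1/2) ^ 2)
      \<longlonglongrightarrow> 1 * 1 / 1 ^ 2" by (rule Lim_transform_eventually)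
    then show ?thesis by simp
  qed
  have "(\<lambda>n. L (a + of_nat n) * (sqrt 2 / sqrt 3) *
     (Gamma (a + of_nat n + 3/8) * Gamma (a + of_nat n + 5/8) / Gamma (a + of_nat n + 1/2) ^ 2))
     \<longlonglongrightarrow> C * (sqrt 2 / sqrt 3) * 1"
    by (intro tendsto_mult tendsto_const limL limG)
  moreover have "L (a + of_nat n) * (sqrt 2 / sqrt 3) *
     (Gamma (a + of_nat n + 3/8) * Gamma (a + of_nat n + 5/8) / Gamma (a + of_nat n + 1/2) ^ 2) = Q a" for n
    using QL[of "a + of_nat n"] Q_shift[of n] a by simp
  ultimately have "(\<lambda>n. Q a) \<longlonglongrightarrow> C * (sqrt 2 / sqrt 3) * 1" by simp
  then have "Q a = C * (sqrt 2 / sqrt 3) * 1" by (rule LIMSEQ_unique[OF tendsto_const])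
  also have "C = sqrt 2 * cos (pi / 8)"
  proof -
    have "1 + sqrt (1/2) = 2 * cos (pi / 8) ^ 2"
    proof -
      have "2 * cos (pi / 8) ^ 2 = 1 + sqrt 2 / 2"
      proof -
        have "cos (pi / 4) = 2 * cos (pi / 8) ^ 2 - 1" using cos_double_cos[of "pi / 8"] by simp
        then show ?thesis unfolding cos_45 by linarith
      qed
      moreover have "sqrt (1/2) = sqrt 2 / 2" by (rule real_sqrt_unique) (simp_all add: power_divide)
      ultimately show ?thesis by simp
    qed
    moreover have "cos (pi / 8) > 0" by (intro cos_gt_zero) auto
    ultimately show ?thesis by (simp add: C_def real_sqrt_mult)
  qed
  finally have Qa: "Q a = 2 * cos (pi / 8) / sqrt 3" by simp
  have "F a = Q a * (3 powr (3 * a) / 2 powr (5 * a))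
     * (Gamma (a + 1/3) * Gamma (a + 2/3)) / (Gamma (a + 3/8) * Gamma (a + 5/8))"
    unfolding Q_def using a by (simp add: Gamma_eq_zero_iff pos_notin_nonpos_Ints)
  then show ?thesis unfolding Qa F_def .
qed

section \<open>The closed form for complex parameters\<close>

lemma hypergeo_term_eq_hg_term: "hypergeo_term a (1/2 - a) (3 * a) (1/2) = hg_term a"
  by (rule ext) (simp add: hypergeo_term_def hg_term_def pochhammer_fact[symmetric] power_divide)

definition closed_form :: "complex \<Rightarrow> complex" where
  "closed_form a = 2 powr (3/4 - 5 * a) * of_real (sqrt pi) * Gamma (3/4)
                * Gamma (a + 1/3) * Gamma (a + 2/3)
              / (3 powr (3/8 - 3 * a))
              * rGamma (11/24) * rGamma (19/24) * rGamma (a + 3/8) * rGamma (a + 5/8)"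

lemma holomorphic_closed_form: "closed_form holomorphic_on hg_dom"
proof -
  have nonpos: "a + 1/3 \<notin> \<int>\<^sub>\<le>\<^sub>0" "a + 2/3 \<notin> \<int>\<^sub>\<le>\<^sub>0" if "a \<in> hg_dom" for a :: complex
  proof -
    have aux: "a + c / 3 \<notin> \<int>\<^sub>\<le>\<^sub>0" if c: "c = of_nat m" for c m
    proof
      assume "a + c / 3 \<in> \<int>\<^sub>\<le>\<^sub>0"
      then obtain n where n: "a + c / 3 = - of_nat n" by (elim nonpos_Ints_cases')
      have "3 * a = 3 * (a + c / 3) - c" by (simp add: distrib_left)
      also have "\<dots> = - of_nat (3 * n + m)" unfolding n by (simp add: c)
      finally have "3 * a = - of_nat (3 * n + m)" .
      then have "3 * a \<in> \<int>\<^sub>\<le>\<^sub>0" by (simp only: minus_of_nat_in_nonpos_Ints)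
      with \<open>a \<in> hg_dom\<close> show False by (simp add: hg_dom_def)
    qed
    show "a + 1/3 \<notin> \<int>\<^sub>\<le>\<^sub>0" "a + 2/3 \<notin> \<int>\<^sub>\<le>\<^sub>0" using aux[of 1 1] aux[of 2 2] by simp_all
  qed
  have 2: "(\<lambda>a. 2 powr (3/4 - 5 * a) :: complex) holomorphic_on hg_dom"
    unfolding powr_def by (auto intro!: holomorphic_intros)
  have 3: "(\<lambda>a. 3 powr (3/8 - 3 * a) :: complex) holomorphic_on hg_dom"
    unfolding powr_def by (auto intro!: holomorphic_intros)
  show ?thesis
    unfolding closed_form_def[abs_def]
    by (intro holomorphic_on_mult holomorphic_on_divide 2 3 holomorphic_on_const
        holomorphic_Gamma' holomorphic_rGamma' holomorphic_on_add holomorphic_on_ident nonpos)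
       (auto simp: powr_eq_0_iff)
qed

lemma closed_form_of_real:
  fixes a :: real
  assumes a: "a > 1"
  shows "closed_form (of_real a) = (\<Sum>k. hg_term (complex_of_real a) k)"
proof -
  have p2: "(2 :: complex) powr (3/4 - 5 * of_real a) = of_real (2 powr (3/4 - 5 * a))"
    using powr_of_real[of 2 "3/4 - 5 * a"] by simp
  have p3: "(3 :: complex) powr (3/8 - 3 * of_real a) = of_real (3 powr (3/8 - 3 * a))"
    using powr_of_real[of 3 "3/8 - 3 * a"] by simp
  have c: "complex_of_real a + 1/3 = of_real (a + 1/3)" "complex_of_real a + 2/3 = of_real (a + 2/3)"
    "complex_of_real a + 3/8 = of_real (a + 3/8)" "complex_of_real a + 5/8 = of_real (a + 5/8)"
    "(3/4 :: complex) = of_real (3/4)" "(11/24 :: complex) = of_real (11/24)"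
    "(19/24 :: complex) = of_real (19/24)" by simp_all
  have "closed_form (of_real a) = of_real (2 powr (3/4 - 5 * a) * sqrt pi * Gamma (3/4)
      * Gamma (a + 1/3) * Gamma (a + 2/3) / (3 powr (3/8 - 3 * a))
      * rGamma (11/24) * rGamma (19/24) * rGamma (a + 3/8) * rGamma (a + 5/8))"
    unfolding closed_form_def p2 p3
    unfolding c Gamma_complex_of_real rGamma_complex_of_real by simp
  also have "2 powr (3/4 - 5 * a) * sqrt pi * Gamma (3/4)
      * Gamma (a + 1/3) * Gamma (a + 2/3) / (3 powr (3/8 - 3 * a))
      * rGamma (11/24) * rGamma (19/24) * rGamma (a + 3/8) * rGamma (a + 5/8)
    = (2 powr (3/4) * sqrt pi * Gamma (3/4) / (3 powr (3/8) * Gamma (11/24) * Gamma (19/24)))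
      * (3 powr (3 * a) / 2 powr (5 * a))
      * (Gamma (a + 1/3) * Gamma (a + 2/3)) / (Gamma (a + 3/8) * Gamma (a + 5/8))"
  proof -
    have "A / B * p * g * g1 * g2 / (c / d) * inverse h1 * inverse h2 * inverse h3 * inverse h4
        = (A * p * g / (c * h1 * h2)) * (d / B) * (g1 * g2) / (h3 * h4)"
      for A B c d p g g1 g2 h1 h2 h3 h4 :: real by (simp add: field_simps)
    then show ?thesis unfolding powr_diff rGamma_inverse_Gamma .
  qed
  also have "\<dots> = (\<Sum>k. hg_term a k)"
    unfolding Gamma_constant_eq_cos hg_series_closed_form_real[OF a] ..
  also have "complex_of_real \<dots> = (\<Sum>k. hg_term (complex_of_real a) k)"
    unfolding hg_term_of_real using a by (intro suminf_of_real summable_hg_term) simp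
  finally show ?thesis .
qed

text \<open>
  Both sides are holomorphic in \<open>a\<close> on a connected domain, and they agree on a real half-line.
\<close>

lemma hg_series_closed_form:
  assumes "3 * a \<notin> \<int>\<^sub>\<le>\<^sub>0"
  shows "(\<Sum>k. hg_term a k) = closed_form a"
proof -
  define U where "U = complex_of_real ` {1<..}"
  have sub: "U \<subseteq> hg_dom"
  proof
    fix z assume "z \<in> U"
    then obtain x where x: "z = of_real x" "x > 1" by (auto simp: U_def)
    have "3 * z = of_real (3 * x)" by (simp add: x)
    then show "z \<in> hg_dom"
      unfolding hg_dom_def mem_Collect_eq using pos_notin_nonpos_Ints[of "3 * x"] x
      by (simp only: of_real_in_nonpos_Ints_iff) simp
  qed
  have "2 islimpt U"
    unfolding islimpt_approachable
  proof (intro allI impI)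
    fix e :: real assume "e > 0"
    moreover from this have "complex_of_real (2 + e / 2) \<in> U" unfolding U_def by (intro imageI) simp
    ultimately show "\<exists>x'\<in>U. x' \<noteq> 2 \<and> dist x' 2 < e"
      by (intro bexI[of _ "of_real (2 + e / 2)"]) (auto simp: dist_norm norm_divide)
  qed
  moreover have "2 \<in> U" by (auto simp: U_def intro!: image_eqI[of _ _ 2])
  moreover have "(\<Sum>k. hg_term z k) - closed_form z = 0" if "z \<in> U" for z
    using that closed_form_of_real by (auto simp: U_def)
  moreover have "(\<lambda>a. (\<Sum>k. hg_term a k) - closed_form a) holomorphic_on hg_dom"
    by (intro holomorphic_on_diff holomorphic_hg_series holomorphic_closed_form)
  moreover have "a \<in> hg_dom" using assms by (simp add: hg_dom_def)
  ultimately have "(\<Sum>k. hg_term a k) - closed_form a = 0"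
    using analytic_continuation[of "\<lambda>a. (\<Sum>k. hg_term a k) - closed_form a" hg_dom U 2 a]
      open_hg_dom connected_hg_dom sub by blast
  then show ?thesis by simp
qed

theorem mainTheorem9:
  shows "(\<forall>a :: complex. 3 * a \<notin> \<int>\<^sub>\<le>\<^sub>0 \<longrightarrow>
            hypergeo_F a (1/2 - a) (3 * a) (1/2) =
              2 powr (3/4 - 5 * a) * of_real (sqrt pi) * Gamma (3/4)
                * Gamma (a + 1/3) * Gamma (a + 2/3)
              / (3 powr (3/8 - 3 * a))
              * rGamma (11/24) * rGamma (19/24) * rGamma (a + 3/8) * rGamma (a + 5/8))
       \<and> (\<forall>(a :: complex) (n :: nat). a = - 1 - of_nat n \<longrightarrow>
            hypergeo_F a (1/2 - a) (3 * a) (1/2) =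
              (5 * 2 powi (5 * int n - 2) * pochhammer (13/8) n * pochhammer (11/8) n)
              / (3 ^ (3 * n) * pochhammer (5/3) n * pochhammer (4/3) n))"
proof (intro conjI allI impI)
  fix a :: complex
  assume a: "3 * a \<notin> \<int>\<^sub>\<le>\<^sub>0"
  then have "hypergeo_F a (1/2 - a) (3 * a) (1/2) = (\<Sum>k. hg_term a k)"
    by (simp add: hypergeo_F_def hypergeo_term_eq_hg_term)
  then show "hypergeo_F a (1/2 - a) (3 * a) (1/2) =
      2 powr (3/4 - 5 * a) * of_real (sqrt pi) * Gamma (3/4)
        * Gamma (a + 1/3) * Gamma (a + 2/3)
      / (3 powr (3/8 - 3 * a))
      * rGamma (11/24) * rGamma (19/24) * rGamma (a + 3/8) * rGamma (a + 5/8)"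
    unfolding hg_series_closed_form[OF a] closed_form_def .
next
  fix a :: complex and n :: nat
  assume a: "a = - 1 - of_nat n"
  have a': "a = - of_nat (Suc n)" "3 * a = - of_nat (3 * Suc n)" by (simp_all add: a)
  have "a \<in> \<int>\<^sub>\<le>\<^sub>0" unfolding a'(1) by (rule minus_of_nat_in_nonpos_Ints)
  moreover have "3 * a \<in> \<int>\<^sub>\<le>\<^sub>0" unfolding a'(2) by (rule minus_of_nat_in_nonpos_Ints)
  moreover have "Re (3 * a) < Re a" by (simp add: a)
  moreover have "nat \<lfloor>norm a\<rfloor> = Suc n" unfolding a'(1) norm_minus_cancel norm_of_nat by simp
  ultimately have "hypergeo_F a (1/2 - a) (3 * a) (1/2) = (\<Sum>k\<le>Suc n. hg_term a k)"
    by (simp add: hypergeo_F_def hypergeo_term_eq_hg_term atLeast0AtMost del: sum.atMost_Suc)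
  also have "\<dots> = (5 * 2 powi (5 * int n - 2) * pochhammer (13/8) n * pochhammer (11/8) n)
      / (3 ^ (3 * n) * pochhammer (5/3) n * pochhammer (4/3) n)"
    unfolding a by (rule hg_finite_sum)
  finally show "hypergeo_F a (1/2 - a) (3 * a) (1/2) =
      (5 * 2 powi (5 * int n - 2) * pochhammer (13/8) n * pochhammer (11/8) n)
      / (3 ^ (3 * n) * pochhammer (5/3) n * pochhammer (4/3) n)" .
qed

end
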